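(* The automorphism groups of the following Lie conformal superalgebras $\mathbb{C}[\partial]A\oplus\mathbb{C}[\partial]B\oplus\mathbb{C}[\partial]X$ (defined in the context) are, up to isomorphism of groups: - $\mathrm{Aut}(\mathcal{A}_1)\cong(\mathbb{C}^*\ltimes\mathbb{C}[\partial])\times\mathbb{C}^*$ if $\phi_1(\lambda)=0$; - $\mathrm{Aut}(\mathcal{A}_1)\cong\mathbb{C}[\partial]\times\mathbb{C}^*$ if $\phi_1(\lambda)\ne0$; - $\mathrm{Aut}(\mathcal{A}_2)\cong(\mathbb{C}^*\ltimes\mathbb{C}[\partial])\times\mathbb{C}^*$ if $\psi(\partial)=0$; - $\mathrm{Aut}(\mathcal{A}_2)\cong(\mathbb{C}^*\ltimes\mathbb{C}[\partial])\times\mathbb{Z}_2$ if $\psi(\partial)\ne0$; - $\mathrm{Aut}(\mathcal{A}_3)\cong\mathbb{C}^*\ltimes\mathbb{C}$; - $\mathrm{Aut}(\mathcal{A}_4)\cong(\mathbb{C}^*\ltimes\mathbb{C})\times\mathbb{C}^*$; - $\mathrm{Aut}(\mathcal{B}_1)\cong\mathbb{C}^*$; - $\mathrm{Aut}(\mathcal{B}_2)\cong\mathbb{Z}_2$; - $\mathrm{Aut}(\mathcal{C}_1)\cong\mathbb{C}^*\times\mathbb{C}^*$; - $\mathrm{Aut}(\mathcal{C}_2)\cong\mathbb{C}^*\times\mathbb{Z}_2$; - $\mathrm{Aut}(\mathcal{C}_3)\cong\mathbb{C}^*$.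
   Context: A Lie conformal superalgebra is a $\mathbb{Z}_2$-graded $\mathbb{C}[\partial]$-module $R=R_{\bar 0}\oplus R_{\bar 1}$ with a $\mathbb{C}$-linear parity-compatible map $R\otimes R\to\mathbb{C}[\lambda]\otimes R$, $a\otimes b\mapsto[a_\lambda b]$, such that $[\partial a_\lambda b]=-\lambda[a_\lambda b]$, $[a_\lambda\partial b]=(\partial+\lambda)[a_\lambda b]$, $[a_\lambda b]=-(-1)^{|a||b|}[b_{-\lambda-\partial}a]$ and $[a_\lambda[b_\mu c]]=[[a_\lambda b]_{\lambda+\mu}c]+(-1)^{|a||b|}[b_\mu[a_\lambda c]]$. $\mathrm{Aut}(R)$ is the group, under composition, of parity-preserving bijective linear maps $\sigma:R\to R$ with $\sigma\partial=\partial\sigma$ and $\sigma([a_\lambda b])=[\sigma(a)_\lambda\sigma(b)]$. Below $A,B$ are even, $X$ is odd, $\{A,B,X\}$ is a $\mathbb{C}[\partial]$-basis; omitted brackets vanish or follow from skew-symmetry. A polynomial $f(x,y)$ is skew-symmetric if $f(x,y)=-f(x,-x-y)$. $\mathcal{A}_1$: $[A_\lambda A]=f_1(\partial,\lambda)B$, $[A_\lambda X]=\phi_1(\lambda)X$ ($f_1\neq0$ skew-symmetric; $\phi_1\in\mathbb{C}[\lambda]$). $\mathcal{A}_2$: $[A_\lambda A]=f_2(\partial,\lambda)B$, $[X_\lambda X]=\psi(\partial)B$ ($f_2\ne0$ skew-symmetric, $\psi\in\mathbb{C}[\partial]$). $\mathcal{A}_3$: $[A_\lambda B]=2\phi_3(\lambda)B$,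 $[A_\lambda X]=\phi_3(\lambda)X$, $[X_\lambda X]=2B$ ($0\ne\phi_3\in\mathbb{C}[\lambda]$). $\mathcal{A}_4$: $[A_\lambda B]=p(\lambda)B$, $[A_\lambda X]=\phi_4(\lambda)X$ ($0\ne p\in\mathbb{C}[\lambda]$, $\phi_4\in\mathbb{C}[\lambda]$). $\mathcal{B}_1$: $[A_\lambda A]=(\partial+2\lambda)A$, $[B_\lambda B]=(\partial+2\lambda)B$, $[A_\lambda X]=(\partial+\alpha\lambda+\beta)X$ ($\alpha,\beta\in\mathbb{C}$). $\mathcal{B}_2$: $[A_\lambda A]=(\partial+2\lambda)A$, $[B_\lambda B]=(\partial+2\lambda)B$, $[A_\lambda X]=(\partial+\frac32\lambda)X$, $[X_\lambda X]=2A$. $\mathcal{C}_1$: $[A_\lambda A]=(\partial+2\lambda)A$, $[A_\lambda X]=(\partial+\alpha\lambda+\beta)X$ ($\alpha,\beta\in\mathbb{C}$). $\mathcal{C}_2$: $[A_\lambda A]=(\partial+2\lambda)A$, $[A_\lambda X]=(\partial+\frac32\lambda)X$, $[X_\lambda X]=2A$. $\mathcal{C}_3$: $[A_\lambda A]=(\partial+2\lambda)A$, $[B_\lambda X]=\varphi(\lambda)X$ ($0\ne\varphi\in\mathbb{C}[\lambda]$). Group notation: $\mathbb{C}^*$ is the multiplicative group of nonzero complex numbers; $\mathbb{C}$ and $\mathbb{C}[\partial]$ are additive groups; $\mathbb{C}^*\ltimes V$ denotes a semidirect product in which $\mathbb{C}^*$ acts on the complex vector space $V$ by scalars through a character $z\mapsto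 z^m$ for some nonzero integer $m$. *)

theory Defs
  imports
    Complex_Main
    "HOL-Computational_Algebra.Polynomial"
    "HOL-Library.Z2"
    "HOL-Algebra.Group"
begin

text \<open>
  The underlying space \<open>R\<close> is the whole type \<open>'r\<close>. \<open>scl\<close> is the action of \<open>\<complex>[\<partial>]\<close>, where
  \<open>complex poly\<close> is \<open>\<complex>[\<partial>]\<close>; \<open>part i\<close> is the homogeneous component of parity \<open>i \<in> \<int>/2\<close>;
  and \<open>br a b\<close> is the \<open>\<lambda>\<close>-bracket, an element of \<open>\<complex>[\<lambda>] \<otimes> R = R[\<lambda>]\<close>, represented by \<open>'r poly\<close>.
\<close>

record (overloaded) ('r :: ab_group_add) conf_structure =
  scl :: "complex poly \<Rightarrow> 'r \<Rightarrow> 'r"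
  part :: "bit \<Rightarrow> 'r set"
  br :: "'r \<Rightarrow> 'r \<Rightarrow> 'r poly"

definition cscl :: "'r::ab_group_add conf_structure \<Rightarrow> complex \<Rightarrow> 'r \<Rightarrow> 'r" where
  "cscl R c a = scl R [:c:] a"

definition der :: "'r::ab_group_add conf_structure \<Rightarrow> 'r \<Rightarrow> 'r" where
  "der R a = scl R [:0, 1:] a"

text \<open>
  \<open>complex poly poly\<close> plays two roles, the outer variable being written second:
  it is \<open>\<complex>[\<partial>, \<lambda>]\<close>, acting on \<open>R\<close> with values in \<open>R[\<lambda>]\<close>, and it is \<open>\<complex>[\<lambda>, \<mu>]\<close>, acting on \<open>R\<close>
  with values in \<open>R[\<lambda>, \<mu>]\<close>.
\<close>

definition var_in :: "complex poly poly" where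
  "var_in = [:[:0, 1:]:]"

definition var_out :: "complex poly poly" where
  "var_out = [:0, 1:]"

definition act :: "'r::ab_group_add conf_structure \<Rightarrow> complex poly poly \<Rightarrow> 'r \<Rightarrow> 'r poly" where
  "act R f a = map_poly (\<lambda>q. scl R q a) f"

definition act2 :: "'r::ab_group_add conf_structure \<Rightarrow> complex poly poly \<Rightarrow> 'r \<Rightarrow> 'r poly poly" where
  "act2 R g a = map_poly (map_poly (\<lambda>c. cscl R c a)) g"

text \<open>\<open>p(-\<lambda>-\<partial>)\<close>, where powers of \<open>-\<lambda>-\<partial>\<close> act on the coefficients of \<open>p \<in> R[\<lambda>]\<close> from the left.\<close>

definition skew_subst :: "'r::ab_group_add conf_structure \<Rightarrow> 'r poly \<Rightarrow> 'r poly" where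
  "skew_subst R p = (\<Sum>i\<le>degree p. act R ((- var_out - var_in) ^ i) (coeff p i))"

text \<open>
  For \<open>p = \<Sum>\<^sub>i t\<^sup>i r\<^sub>i \<in> R[t]\<close> and \<open>F : R \<rightarrow> R[s]\<close>, the element \<open>\<Sum>\<^sub>i x\<^sup>i F(r\<^sub>i)(y)\<close> of \<open>R[\<lambda>, \<mu>]\<close>,
  for \<open>x, y \<in> \<complex>[\<lambda>, \<mu>]\<close>. The three iterated brackets of the Jacobi identity have this form.
\<close>

definition nest :: "'r::ab_group_add conf_structure \<Rightarrow> complex poly poly \<Rightarrow> complex poly poly
    \<Rightarrow> 'r poly \<Rightarrow> ('r \<Rightarrow> 'r poly) \<Rightarrow> 'r poly poly" where
  "nest R x y p F =
     (\<Sum>i\<le>degree p. \<Sum>k\<le>degree (F (coeff p i)). act2 R (x ^ i * y ^ k) (coeff (F (coeff p i)) k))"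

definition super_sign :: "bit \<Rightarrow> bit \<Rightarrow> 'b::ab_group_add \<Rightarrow> 'b" where
  "super_sign i j v = (if i * j = 1 then - v else v)"

definition lie_conformal_superalgebra :: "'r::ab_group_add conf_structure \<Rightarrow> bool" where
  "lie_conformal_superalgebra R \<longleftrightarrow>
     module (scl R) \<and>
     (\<forall>i. module.subspace (scl R) (part R i)) \<and>
     part R 0 \<inter> part R 1 = {0} \<and>
     (\<forall>a. \<exists>u\<in>part R 0. \<exists>v\<in>part R 1. a = u + v) \<and>
     (\<forall>a. Vector_Spaces.linear (cscl R) (\<lambda>c. map_poly (cscl R c)) (\<lambda>b. br R a b)) \<and>
     (\<forall>b. Vector_Spaces.linear (cscl R) (\<lambda>c. map_poly (cscl R c)) (\<lambda>a. br R a b)) \<and>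
     (\<forall>i j. \<forall>a\<in>part R i. \<forall>b\<in>part R j. \<forall>n. coeff (br R a b) n \<in> part R (i + j)) \<and>
     (\<forall>a b. br R (der R a) b = - pCons 0 (br R a b)) \<and>
     (\<forall>a b. br R a (der R b) = map_poly (der R) (br R a b) + pCons 0 (br R a b)) \<and>
     (\<forall>i j. \<forall>a\<in>part R i. \<forall>b\<in>part R j.
        br R a b = - super_sign i j (skew_subst R (br R b a))) \<and>
     (\<forall>i j. \<forall>a\<in>part R i. \<forall>b\<in>part R j. \<forall>c.
        nest R var_out var_in (br R b c) (\<lambda>r. br R a r) =
        nest R var_in (var_in + var_out) (br R a b) (\<lambda>r. br R r c) +
        super_sign i j (nest R var_in var_out (br R a c) (\<lambda>r. br R b r)))"

definition Aut :: "'r::ab_group_add conf_structure \<Rightarrow> ('r \<Rightarrow> 'r) monoid" where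
  "Aut R = \<lparr>carrier = {\<sigma>. bij \<sigma> \<and> Vector_Spaces.linear (cscl R) (cscl R) \<sigma> \<and>
                (\<forall>i. \<sigma> ` part R i \<subseteq> part R i) \<and>
                (\<forall>a. \<sigma> (der R a) = der R (\<sigma> a)) \<and>
                (\<forall>a b. map_poly \<sigma> (br R a b) = br R (\<sigma> a) (\<sigma> b))},
            mult = (\<circ>), one = id\<rparr>"


definition super_basis :: "'r::ab_group_add conf_structure \<Rightarrow> 'r \<Rightarrow> 'r \<Rightarrow> 'r \<Rightarrow> bool" where
  "super_basis R A B X \<longleftrightarrow>
     A \<in> part R 0 \<and> B \<in> part R 0 \<and> X \<in> part R 1 \<and> distinct [A, B, X] \<and>
     \<not> module.dependent (scl R) {A, B, X} \<and> module.span (scl R) {A, B, X} = UNIV"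

text \<open>
  In the rest of this   the one-variable polynomial rings \<open>\<complex>[\<partial>]\<close> and \<open>\<complex>[\<lambda>]\<close>. For skew-symmetry, \<open>f(x, y)\<close> has
  inner variable \<open>x\<close> and outer variable \<open>y\<close>.
\<close>

definition in_D :: "complex poly \<Rightarrow> complex poly poly" where
  "in_D q = [:q:]"

definition in_L :: "complex poly \<Rightarrow> complex poly poly" where
  "in_L q = map_poly (\<lambda>c. [:c:]) q"

definition skew_symmetric :: "complex poly poly \<Rightarrow> bool" where
  "skew_symmetric f \<longleftrightarrow> f = - pcompose f (- var_in - var_out)"

definition vir :: "complex poly poly" where
  "vir = var_in + 2 * var_out"

definition vir_mod :: "complex \<Rightarrow> complex \<Rightarrow> complex poly poly" where
  "vir_mod \<alpha> \<beta> = var_in + [:[:\<alpha>:]:] * var_out + [:[:\<beta>:]:]"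

text \<open>
  For a Lie conformal superalgebra with \<open>super_basis R A B X\<close>, the six brackets listed here
  determine all others by skew-symmetry and sesquilinearity. Each \<open>alg_*\<close> below describes
  such an algebra by these six values.
\<close>

definition brackets :: "'r::ab_group_add conf_structure \<Rightarrow> 'r \<Rightarrow> 'r \<Rightarrow> 'r
    \<Rightarrow> 'r poly \<Rightarrow> 'r poly \<Rightarrow> 'r poly \<Rightarrow> 'r poly \<Rightarrow> 'r poly \<Rightarrow> 'r poly \<Rightarrow> bool" where
  "brackets R A B X AA AB AX BB BX XX \<longleftrightarrow>
     br R A A = AA \<and> br R A B = AB \<and> br R A X = AX \<and>
     br R B B = BB \<and> br R B X = BX \<and> br R X X = XX"

definition alg_A1 where
  "alg_A1 R A B X f \<phi> \<longleftrightarrow> f \<noteq> 0 \<and> skew_symmetric f \<and>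
     brackets R A B X (act R f B) 0 (act R (in_L \<phi>) X) 0 0 0"

definition alg_A2 where
  "alg_A2 R A B X f \<psi> \<longleftrightarrow> f \<noteq> 0 \<and> skew_symmetric f \<and>
     brackets R A B X (act R f B) 0 0 0 0 (act R (in_D \<psi>) B)"

definition alg_A3 where
  "alg_A3 R A B X \<phi> \<longleftrightarrow> \<phi> \<noteq> 0 \<and>
     brackets R A B X 0 (act R (2 * in_L \<phi>) B) (act R (in_L \<phi>) X) 0 0 (act R 2 B)"

definition alg_A4 where
  "alg_A4 R A B X p \<phi> \<longleftrightarrow> p \<noteq> 0 \<and>
     brackets R A B X 0 (act R (in_L p) B) (act R (in_L \<phi>) X) 0 0 0"

definition alg_B1 where
  "alg_B1 R A B X \<alpha> \<beta> \<longleftrightarrow>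
     brackets R A B X (act R vir A) 0 (act R (vir_mod \<alpha> \<beta>) X) (act R vir B) 0 0"

definition alg_B2 where
  "alg_B2 R A B X \<longleftrightarrow>
     brackets R A B X (act R vir A) 0 (act R (vir_mod (3 / 2) 0) X) (act R vir B) 0 (act R 2 A)"

definition alg_C1 where
  "alg_C1 R A B X \<alpha> \<beta> \<longleftrightarrow>
     brackets R A B X (act R vir A) 0 (act R (vir_mod \<alpha> \<beta>) X) 0 0 0"

definition alg_C2 where
  "alg_C2 R A B X \<longleftrightarrow>
     brackets R A B X (act R vir A) 0 (act R (vir_mod (3 / 2) 0) X) 0 0 (act R 2 A)"

definition alg_C3 where
  "alg_C3 R A B X \<phi> \<longleftrightarrow> \<phi> \<noteq> 0 \<and>
     brackets R A B X (act R vir A) 0 0 0 (act R (in_L \<phi>) X) 0"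


definition Cstar :: "complex monoid" where
  "Cstar = \<lparr>carrier = UNIV - {0}, mult = (*), one = 1\<rparr>"

definition additive :: "'a::ab_group_add monoid" where
  "additive = \<lparr>carrier = UNIV, mult = (+), one = 0\<rparr>"

abbreviation C_add :: "complex monoid" where
  "C_add \<equiv> additive"

abbreviation CD_add :: "complex poly monoid" where
  "CD_add \<equiv> additive"

abbreviation Z2_add :: "bit monoid" where
  "Z2_add \<equiv> additive"

definition semidirect :: "'g monoid \<Rightarrow> ('g \<Rightarrow> 'v \<Rightarrow> 'v) \<Rightarrow> 'v monoid \<Rightarrow> ('g \<times> 'v) monoid" where
  "semidirect G \<theta> N =
     \<lparr>carrier = carrier G \<times> carrier N,
      mult = (\<lambda>(g, n) (h, k). (g \<otimes>\<^bsub>G\<^esub> h, n \<otimes>\<^bsub>N\<^esub> \<theta> g k)),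
      one = (\<one>\<^bsub>G\<^esub>, \<one>\<^bsub>N\<^esub>)\<rparr>"

definition Cstar_semi_C :: "int \<Rightarrow> (complex \<times> complex) monoid" where
  "Cstar_semi_C m = semidirect Cstar (\<lambda>z v. (z powi m) * v) C_add"

definition Cstar_semi_CD :: "int \<Rightarrow> (complex \<times> complex poly) monoid" where
  "Cstar_semi_CD m = semidirect Cstar (\<lambda>z v. smult (z powi m) v) CD_add"

end

theory Submission
  imports Defs
begin

text \<open>
  An automorphism \<open>\<sigma>\<close> is \<open>\<complex>[\<partial>]\<close>-linear and preserves parity, so on the basis it is given by
  \<open>\<sigma> A = a A + b B\<close>, \<open>\<sigma> B = c A + d B\<close>, \<open>\<sigma> X = x X\<close> with \<open>a, b, c, d, x \<in> \<complex>[\<partial>]\<close>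
  (\<open>Aut_eq_block\<close>). By sesquilinearity and skew-symmetry such a map preserves all brackets as soon
  as it preserves the six brackets of basis vectors, and comparing coordinates turns this into ten
  polynomial identities in \<open>\<partial>\<close> and \<open>\<lambda>\<close>. Two polynomials are equal when they agree at all pairs of
  complex numbers, so the identities are stated pointwise, which makes substitutions such as
  \<open>\<lambda> \<mapsto> - \<lambda> - \<partial>\<close> ordinary function composition (\<open>block_in_Aut_iff\<close>).

  In every family the identities force \<open>c = 0\<close>. In the families without a Virasoro element, \<open>\<sigma> B\<close>
  occurs, times a nonzero polynomial, in the image of a bracket of two generators and must be a
  multiple of \<open>B\<close>. If \<open>A\<close> is a Virasoro element, then
  \<open>[A\<^sub>\<lambda> B] = 0\<close> yields \<open>a(-\<lambda>) c(\<partial> + \<lambda>) (\<partial> + 2\<lambda>) = 0\<close>, so \<open>a = 0\<close> or \<open>c = 0\<close>, and \<open>a = 0\<close> is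
  excluded because it would make \<open>X\<close> or \<open>A\<close> map to \<open>0\<close>.

  Once \<open>c = 0\<close>, bijectivity makes \<open>a\<close>, \<open>d\<close>, \<open>x\<close> units of \<open>\<complex>[\<partial>]\<close>, that is, nonzero constants;
  only \<open>b\<close> can be a genuine polynomial. Such triangular maps compose by the rule
  \<open>(a', b', d', x') (a, b, d, x) = (a' a, a b' + d' b, d' d, x' x)\<close>, and for each family one reads
  off which quadruples are admissible. When \<open>[A\<^sub>\<lambda> A] = f B\<close> with \<open>f \<noteq> 0\<close>, they satisfy \<open>d = a\<^sup>2\<close>
  with \<open>b\<close> arbitrary, and \<open>v = b / a\<close> transforms as in a semidirect product of weight \<open>1\<close>. When
  \<open>[A\<^sub>\<lambda> B] = p(\<lambda>) B\<close> with \<open>p \<noteq> 0\<close> and \<open>[A\<^sub>\<lambda> A] = 0\<close>, one gets \<open>a = 1\<close> and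
  \<open>b(\<partial> + \<lambda>) p(\<lambda>) = b(-\<lambda>) p(-\<lambda>-\<partial>)\<close>, which says that \<open>b\<close> is a scalar multiple of \<open>p(-\<partial>)\<close>
  (\<open>proportional_iff\<close>). With a Virasoro element, \<open>a = 1\<close> and \<open>b = 0\<close>. The isomorphisms then come
  from explicit parametrisations of the admissible quadruples (\<open>Aut_isoI\<close>).
\<close>

section \<open>Polynomials in two variables as functions\<close>

text \<open>
  The value at \<open>\<partial> = s\<close> and \<open>\<lambda> = t\<close>.
\<close>

definition ev :: "complex poly poly \<Rightarrow> complex \<Rightarrow> complex \<Rightarrow> complex" where
  "ev F s t = poly (poly F [:t:]) s"

lemma ev_simps [simp]:
  "ev 0 s t = 0" "ev 1 s t = 1"
  "ev (F + G) s t = ev F s t + ev G s t"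
  "ev (F - G) s t = ev F s t - ev G s t"
  "ev (- F) s t = - ev F s t"
  "ev (F * G) s t = ev F s t * ev G s t"
  "ev [:q:] s t = poly q s"
  "ev (smult q F) s t = poly q s * ev F s t"
  "ev (numeral n) s t = numeral n"
  by (simp_all add: ev_def)

lemma ev_var [simp]: "ev var_in s t = s" "ev var_out s t = t"
  by (simp_all add: ev_def var_in_def var_out_def)

lemma ev_pcompose: "ev (pcompose F G) s t = ev F s (ev G s t)"
  by (induction F) (simp_all add: ev_def pcompose_pCons poly_pcompose)

lemma ev_in_L [simp]: "ev (in_L q) s t = poly q t"
  by (induction q) (simp_all add: ev_def in_L_def map_poly_pCons)

lemma ev_in_D [simp]: "ev (in_D q) s t = poly q s"
  by (simp add: in_D_def)

lemma ev_vir [simp]: "ev vir s t = s + 2 * t"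
  by (simp add: vir_def)

lemma ev_vir_mod [simp]: "ev (vir_mod \<alpha> \<beta>) s t = s + \<alpha> * t + \<beta>"
  by (simp add: vir_mod_def)

text \<open>
  A polynomial over the integral domain \<open>\<complex>[\<partial>]\<close> with a root at each of the infinitely many constants
  vanishes; so polynomial identities can be checked, and exploited, pointwise.
\<close>

lemma ev_eq_iff: "F = G \<longleftrightarrow> (\<forall>s t. ev F s t = ev G s t)"
proof
  assume *: "\<forall>s t. ev F s t = ev G s t"
  have "poly (F - G) [:t:] = 0" for t
    using * by (simp add: ev_def poly_eq_poly_eq_iff [symmetric] fun_eq_iff)
  then have "range (\<lambda>t. [:t:]) \<subseteq> {x. poly (F - G) x = 0}"
    by auto
  moreover have "infinite (range (\<lambda>t::complex. [:t:]))"
    by (simp add: finite_image_iff inj_on_def infinite_UNIV_char_0)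
  ultimately have "F - G = 0"
    using poly_roots_finite finite_subset by blast
  then show "F = G" by simp
qed auto

text \<open>
  The two substitutions of sesquilinearity: \<open>p(-\<lambda>)\<close> comes out of the left argument of a bracket
  and \<open>p(\<partial> + \<lambda>)\<close> out of the right one.
\<close>

definition at_minus_lam :: "complex poly \<Rightarrow> complex poly poly" where
  "at_minus_lam p = pcompose (in_L p) (- var_out)"

definition at_sum :: "complex poly \<Rightarrow> complex poly poly" where
  "at_sum p = pcompose (in_L p) (var_in + var_out)"

lemma ev_at [simp]:
  "ev (at_minus_lam p) s t = poly p (- t)"
  "ev (at_sum p) s t = poly p (s + t)"
  by (simp_all add: at_minus_lam_def at_sum_def ev_pcompose)

lemma at_pCons:
  "at_minus_lam (pCons c p) = [:[:c:]:] - var_out * at_minus_lam p"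
  "at_sum (pCons c p) = [:[:c:]:] + (var_in + var_out) * at_sum p"
  by (simp_all add: ev_eq_iff algebra_simps)

section \<open>Lie conformal superalgebras with a basis of two even and one odd vectors\<close>

locale conf_basis =
  fixes R :: "'r::ab_group_add conf_structure" and A B X :: 'r
  assumes lcsa: "lie_conformal_superalgebra R" and basis: "super_basis R A B X"
begin

sublocale scl: module "scl R"
  using lcsa by (simp add: lie_conformal_superalgebra_def)

lemma linear_br:
  "Vector_Spaces.linear (cscl R) (\<lambda>c. map_poly (cscl R c)) (\<lambda>b. br R a b)"
  "Vector_Spaces.linear (cscl R) (\<lambda>c. map_poly (cscl R c)) (\<lambda>a. br R a b)"
  using lcsa by (simp_all add: lie_conformal_superalgebra_def)

lemma br_der:
  "br R (der R a) b = - pCons 0 (br R a b)"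
  "br R a (der R b) = map_poly (der R) (br R a b) + pCons 0 (br R a b)"
  using lcsa by (simp_all add: lie_conformal_superalgebra_def)

lemma br_skew:
  assumes "a \<in> part R i" "b \<in> part R j"
  shows "br R a b = - super_sign i j (skew_subst R (br R b a))"
proof -
  have "\<forall>i j. \<forall>a\<in>part R i. \<forall>b\<in>part R j. br R a b = - super_sign i j (skew_subst R (br R b a))"
    using lcsa unfolding lie_conformal_superalgebra_def by blast
  then show ?thesis using assms by blast
qed

lemma br_add:
  "br R a (b + b') = br R a b + br R a b'" "br R (a + a') b = br R a b + br R a' b"
  using linear_br unfolding Vector_Spaces.linear_iff by blast+

lemma br_0 [simp]: "br R a 0 = 0" "br R 0 b = 0"
  using br_add(1)[of a 0 0] br_add(2)[of 0 0 b] by simp_all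

lemma br_cscl:
  "br R a (cscl R c b) = map_poly (cscl R c) (br R a b)"
  "br R (cscl R c a) b = map_poly (cscl R c) (br R a b)"
  using linear_br unfolding Vector_Spaces.linear_iff by blast+

lemma cscl_vector_space: "vector_space (cscl R)"
  using linear_br(1) unfolding Vector_Spaces.linear_iff by blast

lemma scl_pCons: "scl R (pCons c q) v = cscl R c v + der R (scl R q v)"
proof -
  have "pCons c q = [:c:] + [:0, 1:] * q" by simp
  then show ?thesis
    unfolding cscl_def der_def by (metis scl.scale_left_distrib scl.scale_scale)
qed

text \<open>
  Every polynomial arises from constants and multiplication by \<open>\<partial>\<close>, so a property stable under
  these operations and sums is stable under \<open>\<complex>[\<partial>]\<close>. The bracket axioms speak of constants and \<open>\<partial>\<close>
  only.
\<close>

lemma scl_closed_induct [consumes 1, case_names add cscl der]: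
  assumes "P v" "\<And>v w. P v \<Longrightarrow> P w \<Longrightarrow> P (v + w)" "\<And>c v. P v \<Longrightarrow> P (cscl R c v)"
    "\<And>v. P v \<Longrightarrow> P (der R v)"
  shows "P (scl R q v)"
proof (induction q)
  case 0
  from assms(3)[OF assms(1), of 0] show ?case by (simp add: cscl_def)
next
  case (pCons c q)
  then show ?case unfolding scl_pCons using assms by blast
qed

subsection \<open>Coordinates\<close>

definition vec :: "complex poly \<Rightarrow> complex poly \<Rightarrow> complex poly \<Rightarrow> 'r" where
  "vec a b x = scl R a A + scl R b B + scl R x X"

lemma vec_add: "vec a b x + vec a' b' x' = vec (a + a') (b + b') (x + x')"
  by (simp add: vec_def scl.scale_left_distrib)

lemma scl_vec: "scl R q (vec a b x) = vec (q * a) (q * b) (q * x)"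
  by (simp add: vec_def scl.scale_right_distrib)

lemma vec_basis: "vec 1 0 0 = A" "vec 0 1 0 = B" "vec 0 0 1 = X"
  by (simp_all add: vec_def)

lemma vec_0 [simp]: "vec 0 0 0 = 0"
  by (simp add: vec_def)

lemma vec_eq_0: "vec a b x = 0 \<longleftrightarrow> a = 0 \<and> b = 0 \<and> x = 0"
proof
  assume *: "vec a b x = 0"
  have d: "A \<noteq> B" "A \<noteq> X" "B \<noteq> X" and ind: "\<not> scl.dependent {A, B, X}"
    using basis by (auto simp: super_basis_def)
  let ?k = "\<lambda>v. if v = A then a else if v = B then b else x"
  have "(\<Sum>v\<in>{A, B, X}. scl R (?k v) v) = 0"
    using * d by (simp add: vec_def add.assoc)
  then have "?k v = 0" if "v \<in> {A, B, X}" for v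
    using that by (intro scl.independentD[OF ind, of "{A, B, X}" ?k v]) auto
  from this[of A] this[of B] this[of X] show "a = 0 \<and> b = 0 \<and> x = 0" using d by simp
qed simp

lemma vec_eq_iff [simp]: "vec a b x = vec a' b' x' \<longleftrightarrow> a = a' \<and> b = b' \<and> x = x'"
proof -
  have "vec a b x - vec a' b' x' = vec (a - a') (b - b') (x - x')"
    by (simp add: vec_def scl.scale_left_diff_distrib)
  moreover have "vec a b x = vec a' b' x' \<longleftrightarrow> vec a b x - vec a' b' x' = 0"
    by (rule right_minus_eq[symmetric])
  ultimately show ?thesis by (simp only: vec_eq_0 right_minus_eq)
qed

lemma vec_exists: "\<exists>a b x. v = vec a b x"
proof -
  have "scl.span {A, B, X} = UNIV" using basis unfolding super_basis_def by blast
  then have "v \<in> scl.span {A, B, X}" by (metis UNIV_I)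
  then obtain a b x where "v - scl R a A - scl R b B - scl R x X \<in> scl.span {}"
    unfolding scl.span_breakdown_eq by blast
  then have "v - scl R a A - scl R b B - scl R x X = 0"
    unfolding scl.span_empty by blast
  then have "v = vec a b x" by (simp only: vec_def diff_diff_eq right_minus_eq)
  then show ?thesis by blast
qed

definition cA where "cA v = (THE a. \<exists>b x. v = vec a b x)"
definition cB where "cB v = (THE b. \<exists>a x. v = vec a b x)"
definition cX where "cX v = (THE x. \<exists>a b. v = vec a b x)"

lemma coord_vec [simp]: "cA (vec a b x) = a" "cB (vec a b x) = b" "cX (vec a b x) = x"
  by (auto simp: cA_def cB_def cX_def)

lemma subspace_part: "scl.subspace (part R i)"
  using lcsa by (simp add: lie_conformal_superalgebra_def)

lemma vec_in_part0: "vec a b 0 \<in> part R 0" and vec_in_part1: "vec 0 0 x \<in> part R 1"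
  using basis subspace_part
  by (auto simp: vec_def super_basis_def intro!: scl.subspace_add scl.subspace_scale)

lemma part_Int: "part R 0 \<inter> part R 1 = {0}"
  using lcsa by (simp add: lie_conformal_superalgebra_def)

lemma part0_iff: "vec a b x \<in> part R 0 \<longleftrightarrow> x = 0"
proof
  assume "vec a b x \<in> part R 0"
  moreover have "vec 0 0 x = vec a b x - vec a b 0" by (simp add: vec_def)
  ultimately have "vec 0 0 x \<in> part R 0"
    using vec_in_part0 scl.subspace_diff[OF subspace_part] by metis
  then have "vec 0 0 x = 0" using vec_in_part1 part_Int by blast
  then show "x = 0" by (simp add: vec_eq_0)
qed (use vec_in_part0 in simp)

lemma part1_iff: "vec a b x \<in> part R 1 \<longleftrightarrow> a = 0 \<and> b = 0"
proof
  assume "vec a b x \<in> part R 1"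
  moreover have "vec a b 0 = vec a b x - vec 0 0 x" by (simp add: vec_def)
  ultimately have "vec a b 0 \<in> part R 1"
    using vec_in_part1 scl.subspace_diff[OF subspace_part] by metis
  then have "vec a b 0 = 0" using vec_in_part0 part_Int by blast
  then show "a = 0 \<and> b = 0" by (simp add: vec_eq_0)
qed (use vec_in_part1 in simp)

subsection \<open>Brackets in coordinates\<close>

lemma coeff_act [simp]: "coeff (act R F v) n = scl R (coeff F n) v"
  by (simp add: act_def coeff_map_poly)

lemma act_0 [simp]: "act R 0 v = 0"
  by (simp add: act_def)

definition actv :: "complex poly poly \<Rightarrow> complex poly poly \<Rightarrow> complex poly poly \<Rightarrow> 'r poly" where
  "actv F G H = act R F A + act R G B + act R H X"

lemma coeff_actv [simp]: "coeff (actv F G H) n = vec (coeff F n) (coeff G n) (coeff H n)"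
  by (simp add: actv_def vec_def)

lemma actv_eq_iff [simp]: "actv F G H = actv F' G' H' \<longleftrightarrow> F = F' \<and> G = G' \<and> H = H'"
  by (auto simp: poly_eq_iff)

lemma actv_add: "actv F G H + actv F' G' H' = actv (F + F') (G + G') (H + H')"
  by (rule poly_eqI) (simp add: vec_add)

lemma actv_0 [simp]: "actv 0 0 0 = 0"
  by (simp add: actv_def)

lemma actv_uminus: "- actv F G H = actv (- F) (- G) (- H)"
  by (rule poly_eqI) (simp add: vec_def scl.scale_minus_left)

lemma pCons_actv: "pCons 0 (actv F G H) = actv (var_out * F) (var_out * G) (var_out * H)"
  by (rule poly_eqI) (simp add: coeff_pCons var_out_def split: nat.split)

lemma map_poly_der_actv:
  "map_poly (der R) (actv F G H) = actv (var_in * F) (var_in * G) (var_in * H)"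
  by (rule poly_eqI) (simp add: coeff_map_poly der_def scl_vec var_in_def)

lemma map_poly_cscl_actv:
  "map_poly (cscl R c) (actv F G H) = actv ([:[:c:]:] * F) ([:[:c:]:] * G) ([:[:c:]:] * H)"
  by (rule poly_eqI) (simp add: coeff_map_poly cscl_def scl_vec)

lemma br_scl_left:
  assumes "br R v w = actv F G H"
  shows "br R (scl R q v) w = actv (at_minus_lam q * F) (at_minus_lam q * G) (at_minus_lam q * H)"
proof (induction q)
  case 0
  then show ?case by (simp add: at_minus_lam_def in_L_def)
next
  case (pCons c q)
  then show ?case
    unfolding scl_pCons br_add br_cscl br_der
    by (simp add: assms map_poly_cscl_actv pCons_actv actv_uminus actv_add at_pCons algebra_simps)
qed

lemma br_scl_right:
  assumes "br R v w = actv F G H"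
  shows "br R v (scl R q w) = actv (at_sum q * F) (at_sum q * G) (at_sum q * H)"
proof (induction q)
  case 0
  then show ?case by (simp add: at_sum_def in_L_def)
next
  case (pCons c q)
  then show ?case
    unfolding scl_pCons br_add br_cscl br_der
    by (simp add: assms map_poly_cscl_actv map_poly_der_actv pCons_actv actv_add at_pCons
        algebra_simps)
qed

text \<open>
  Sesquilinearity iterated over the coefficients of \<open>p\<close> and \<open>q\<close>: it lets the bracket of any two
  vectors be computed from the brackets of the basis.
\<close>

lemma br_scl:
  assumes "br R v w = actv F G H"
  shows "br R (scl R p v) (scl R q w) =
    actv (at_minus_lam p * at_sum q * F) (at_minus_lam p * at_sum q * G)
      (at_minus_lam p * at_sum q * H)"
  using br_scl_right[OF br_scl_left[OF assms]] by (simp add: mult_ac)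

text \<open>
  A summation range independent of the degree, needed for additivity.
\<close>

lemma skew_subst_altdef:
  assumes "degree P \<le> n"
  shows "skew_subst R P = (\<Sum>i\<le>n. act R ((- var_out - var_in) ^ i) (coeff P i))"
proof -
  have "act R G 0 = 0" for G by (rule poly_eqI) simp
  then show ?thesis unfolding skew_subst_def
    by (intro sum.mono_neutral_left) (use assms in \<open>auto simp: coeff_eq_0\<close>)
qed

lemma act_add_right: "act R F (v + w) = act R F v + act R F w"
  by (rule poly_eqI) (simp add: scl.scale_right_distrib)

lemma act_add_left: "act R (F + G) v = act R F v + act R G v"
  by (rule poly_eqI) (simp add: scl.scale_left_distrib)

lemma act_scl: "act R F (scl R q v) = act R (F * [:q:]) v"
  by (rule poly_eqI) (simp add: mult.commute)

lemma act_sum_left: "act R (sum F I) v = (\<Sum>i\<in>I. act R (F i) v)"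
  by (induction I rule: infinite_finite_induct) (simp_all add: act_add_left)

lemma skew_subst_add: "skew_subst R (P + Q) = skew_subst R P + skew_subst R Q"
proof -
  let ?n = "max (degree P) (degree Q)"
  have "degree (P + Q) \<le> ?n" by (rule degree_add_le) auto
  then show ?thesis
    by (simp add: skew_subst_altdef[of _ ?n] act_add_right sum.distrib)
qed

lemma skew_subst_act: "skew_subst R (act R F v) = act R (pcompose F (- var_out - var_in)) v"
proof -
  let ?y = "- var_out - var_in"
  have "degree (act R F v) \<le> degree F"
    by (auto intro!: degree_le simp: coeff_eq_0)
  then have "skew_subst R (act R F v) = (\<Sum>i\<le>degree F. act R (?y ^ i * [:coeff F i:]) v)"
    by (simp add: skew_subst_altdef act_scl)
  also have "\<dots> = act R (\<Sum>i\<le>degree F. [:coeff F i:] * ?y ^ i) v"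
    by (simp add: act_sum_left mult.commute)
  also have "(\<Sum>i\<le>degree F. [:coeff F i:] * ?y ^ i) = pcompose F ?y"
    by (simp add: pcompose_altdef poly_altdef coeff_map_poly degree_map_poly)
  finally show ?thesis .
qed

text \<open>
  The substitution \<open>\<lambda> \<mapsto> -\<lambda> - \<partial>\<close>, by which skew-symmetry acts on coordinates.
\<close>

definition flip :: "complex poly poly \<Rightarrow> complex poly poly" where
  "flip F = pcompose F (- var_out - var_in)"

lemma ev_flip [simp]: "ev (flip F) s t = ev F s (- t - s)"
  by (simp add: flip_def ev_pcompose)

lemma skew_subst_actv: "skew_subst R (actv F G H) = actv (flip F) (flip G) (flip H)"
  by (simp add: actv_def skew_subst_add skew_subst_act flip_def)

subsection \<open>Parity-preserving module endomorphisms\<close>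

text \<open>
  The \<open>\<complex>[\<partial>]\<close>-linear map whose matrix has the rows \<open>(a, b)\<close> and \<open>(c, d)\<close> on the even part, with
  \<open>A \<mapsto> a A + b B\<close> and \<open>B \<mapsto> c A + d B\<close>, and the entry \<open>x\<close> on the odd part.
\<close>

definition block :: "complex poly \<Rightarrow> complex poly \<Rightarrow> complex poly \<Rightarrow> complex poly \<Rightarrow> complex poly
    \<Rightarrow> 'r \<Rightarrow> 'r" where
  "block a b c d x v = vec (cA v * a + cB v * c) (cA v * b + cB v * d) (cX v * x)"

lemma block_vec: "block a b c d x (vec k l m) = vec (k * a + l * c) (k * b + l * d) (m * x)"
  by (simp add: block_def)

lemma block_0 [simp]: "block a b c d x 0 = 0"
  using block_vec[of a b c d x 0 0 0] by simp

lemma block_basis: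
  "block a b c d x A = vec a b 0" "block a b c d x B = vec c d 0" "block a b c d x X = vec 0 0 x"
  using block_vec[of a b c d x 1 0 0] block_vec[of a b c d x 0 1 0] block_vec[of a b c d x 0 0 1]
  by (simp_all add: vec_basis)

lemma block_add: "block a b c d x (v + w) = block a b c d x v + block a b c d x w"
proof -
  obtain k l m k' l' m' where "v = vec k l m" "w = vec k' l' m'" using vec_exists by metis
  then show ?thesis by (simp add: vec_add block_vec algebra_simps)
qed

lemma block_scl: "block a b c d x (scl R q v) = scl R q (block a b c d x v)"
proof -
  obtain k l m where "v = vec k l m" using vec_exists by metis
  then show ?thesis by (simp add: scl_vec block_vec algebra_simps)
qed

lemma map_poly_block_actv:
  "map_poly (block a b c d x) (actv F G H) =
    actv ([:a:] * F + [:c:] * G) ([:b:] * F + [:d:] * G) ([:x:] * H)"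
  by (rule poly_eqI) (simp add: coeff_map_poly block_vec mult.commute)

lemma block_compose:
  "block a' b' c' d' x' \<circ> block a b c d x =
    block (a * a' + b * c') (a * b' + b * d') (c * a' + d * c') (c * b' + d * d') (x * x')"
proof
  fix v
  obtain k l m where "v = vec k l m" using vec_exists by metis
  then show "(block a' b' c' d' x' \<circ> block a b c d x) v =
    block (a * a' + b * c') (a * b' + b * d') (c * a' + d * c') (c * b' + d * d') (x * x') v"
    by (simp add: block_vec algebra_simps)
qed

lemma block_eq_iff:
  "block a b c d x = block a' b' c' d' x' \<longleftrightarrow> a = a' \<and> b = b' \<and> c = c' \<and> d = d' \<and> x = x'"
  using block_basis by (metis vec_eq_iff)

lemma Aut_scl:
  assumes "\<sigma> \<in> carrier (Aut R)"
  shows "\<sigma> (scl R q v) = scl R q (\<sigma> v)"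
proof -
  have add: "\<sigma> (v + w) = \<sigma> v + \<sigma> w" and cscl: "\<sigma> (cscl R c v) = cscl R c (\<sigma> v)"
    and der: "\<sigma> (der R v) = der R (\<sigma> v)" for v w c
    using assms by (auto simp: Aut_def Vector_Spaces.linear_iff)
  show ?thesis
  proof (induction q)
    case 0
    show ?case using cscl[of 0 0] by (simp add: cscl_def)
  next
    case (pCons c q)
    then show ?case unfolding scl_pCons add cscl der by simp
  qed
qed

lemma Aut_eq_block:
  assumes "\<sigma> \<in> carrier (Aut R)"
  obtains a b c d x where "\<sigma> = block a b c d x"
proof -
  have add: "\<sigma> (v + w) = \<sigma> v + \<sigma> w" for v w
    using assms by (auto simp: Aut_def Vector_Spaces.linear_iff)
  have par: "v \<in> part R i \<Longrightarrow> \<sigma> v \<in> part R i" for v i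
    using assms by (auto simp: Aut_def)
  have "\<sigma> A \<in> part R 0" "\<sigma> B \<in> part R 0" "\<sigma> X \<in> part R 1"
    using par basis by (auto simp: super_basis_def)
  then obtain a b c d x where *: "\<sigma> A = vec a b 0" "\<sigma> B = vec c d 0" "\<sigma> X = vec 0 0 x"
    using vec_exists by (metis part0_iff part1_iff)
  have "\<sigma> v = block a b c d x v" for v
  proof -
    obtain k l m where v: "v = vec k l m" using vec_exists by metis
    have "\<sigma> v = scl R k (\<sigma> A) + scl R l (\<sigma> B) + scl R m (\<sigma> X)"
      unfolding v by (simp add: vec_def add Aut_scl[OF assms])
    then show ?thesis by (simp add: * scl_vec vec_add v block_vec)
  qed
  then show thesis using that by blast
qed

lemma block_part: "v \<in> part R i \<Longrightarrow> block a b c d x v \<in> part R i"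
  using vec_exists[of v] by (cases i) (auto simp: block_vec part0_iff part1_iff)

text \<open>
  For fixed \<open>w\<close>, the vectors \<open>v\<close> with \<open>\<sigma>[v\<^sub>\<lambda> w] = [\<sigma>(v)\<^sub>\<lambda> \<sigma>(w)]\<close> form a \<open>\<complex>[\<partial>]\<close>-submodule, and likewise
  in \<open>w\<close>, so pairs of basis vectors suffice. Skew-symmetry, which \<open>\<sigma>\<close> respects because it is
  \<open>\<complex>[\<partial>]\<close>-linear and preserves parity, reduces the nine pairs to six.
\<close>

lemma block_preserves_br_iff_basis:
  fixes a b c d x
  defines "P \<equiv> \<lambda>v w. map_poly (block a b c d x) (br R v w) = br R (block a b c d x v) (block a b c d x w)"
  shows "(\<forall>v w. P v w) \<longleftrightarrow> P A A \<and> P A B \<and> P A X \<and> P B B \<and> P B X \<and> P X X"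
proof
  assume gen: "P A A \<and> P A B \<and> P A X \<and> P B B \<and> P B X \<and> P X X"
  let ?\<sigma> = "block a b c d x"
  have map_add: "map_poly ?\<sigma> (F + G) = map_poly ?\<sigma> F + map_poly ?\<sigma> G" for F G
    by (rule poly_eqI) (simp add: coeff_map_poly block_add)
  have block_uminus: "?\<sigma> (- v) = - ?\<sigma> v" for v
    using block_scl[of a b c d x "- 1" v] by (simp add: scl.scale_minus_left)
  have map_uminus: "map_poly ?\<sigma> (- F) = - map_poly ?\<sigma> F" for F
    by (rule poly_eqI) (simp add: coeff_map_poly block_uminus)
  have map_act: "map_poly ?\<sigma> (act R F v) = act R F (?\<sigma> v)" for F v
    by (rule poly_eqI) (simp add: coeff_map_poly block_scl)
  have block_der: "?\<sigma> (der R v) = der R (?\<sigma> v)" for v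
    by (simp add: der_def block_scl)
  have block_cscl: "?\<sigma> (cscl R k v) = cscl R k (?\<sigma> v)" for k v
    by (simp add: cscl_def block_scl)
  have cscl_0: "cscl R k 0 = 0" and der_0: "der R 0 = 0" for k
    by (simp_all add: cscl_def der_def)
  have skew: "map_poly ?\<sigma> (skew_subst R F) = skew_subst R (map_poly ?\<sigma> F)" for F
  proof -
    have le: "degree (map_poly ?\<sigma> F) \<le> degree F" by (auto intro!: degree_le simp: coeff_map_poly coeff_eq_0)
    have map_sum: "map_poly ?\<sigma> (sum G I) = (\<Sum>i\<in>I. map_poly ?\<sigma> (G i))" for G and I :: "nat set"
      by (induction I rule: infinite_finite_induct) (simp_all add: map_add)
    show ?thesis
      unfolding skew_subst_altdef[OF le] skew_subst_altdef[OF order_refl, of F]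
      by (simp add: map_sum map_act coeff_map_poly)
  qed
  have symm: "P w v" if "P v w" "v \<in> part R i" "w \<in> part R j" for v w i j
    using that br_skew[of w j v i] br_skew[of "?\<sigma> w" j "?\<sigma> v" i] block_part
    by (simp add: P_def super_sign_def map_uminus skew)
  have mem: "A \<in> part R 0" "B \<in> part R 0" "X \<in> part R 1"
    using basis by (auto simp: super_basis_def)
  have nine: "P v w" if "v \<in> {A, B, X}" "w \<in> {A, B, X}" for v w
    using that gen symm[OF _ mem(1) mem(2)] symm[OF _ mem(1) mem(3)] symm[OF _ mem(2) mem(3)]
    by auto
  have addr: "P v (w + w')" if "P v w" "P v w'" for v w w'
    using that by (simp add: P_def br_add map_add block_add)
  have addl: "P (v + v') w" if "P v w" "P v' w" for v v' w
    using that by (simp add: P_def br_add map_add block_add)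
  have sclr: "P v (scl R q w)" if "P v w" for v w q
    using that
  proof (induction rule: scl_closed_induct)
    case (cscl k w)
    then show ?case unfolding P_def block_cscl br_cscl
      by (intro poly_eqI) (auto simp: coeff_map_poly block_cscl cscl_0 poly_eq_iff)
  next
    case (der w)
    then have 1: "map_poly ?\<sigma> (br R v w) = br R (?\<sigma> v) (?\<sigma> w)" by (simp add: P_def)
    show ?case unfolding P_def block_der br_der 1[symmetric]
      by (intro poly_eqI)
        (auto simp: coeff_map_poly block_der block_add der_0 coeff_pCons split: nat.split)
  qed (rule addr)
  have scll: "P (scl R q v) w" if "P v w" for v w q
    using that
  proof (induction rule: scl_closed_induct)
    case (cscl k v)
    then show ?case unfolding P_def block_cscl br_cscl
      by (intro poly_eqI) (auto simp: coeff_map_poly block_cscl cscl_0 poly_eq_iff)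
  next
    case (der v)
    then have 1: "map_poly ?\<sigma> (br R v w) = br R (?\<sigma> v) (?\<sigma> w)" by (simp add: P_def)
    show ?case unfolding P_def block_der br_der 1[symmetric]
      by (intro poly_eqI)
        (auto simp: coeff_map_poly block_uminus coeff_pCons split: nat.split)
  qed (rule addl)
  show "\<forall>v w. P v w"
  proof (intro allI)
    fix v w
    obtain k l m k' l' m' where "v = vec k l m" "w = vec k' l' m'" using vec_exists by metis
    then show "P v w"
      by (simp only: vec_def) (intro addl addr scll sclr; intro nine; simp)
  qed
qed blast

lemma block_in_Aut_iff_basis:
  fixes a b c d x
  defines "P \<equiv> \<lambda>v w. map_poly (block a b c d x) (br R v w) = br R (block a b c d x v) (block a b c d x w)"
  shows "block a b c d x \<in> carrier (Aut R) \<longleftrightarrow>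
    bij (block a b c d x) \<and> P A A \<and> P A B \<and> P A X \<and> P B B \<and> P B X \<and> P X X"
proof -
  have lin: "Vector_Spaces.linear (cscl R) (cscl R) (block a b c d x)"
    using cscl_vector_space by (simp add: Vector_Spaces.linear_iff block_add cscl_def block_scl)
  have par: "block a b c d x ` part R i \<subseteq> part R i" for i
    using block_part by blast
  have "block a b c d x \<in> carrier (Aut R) \<longleftrightarrow> bij (block a b c d x) \<and> (\<forall>v w. P v w)"
    by (simp add: Aut_def lin par der_def block_scl P_def)
  then show ?thesis unfolding P_def block_preserves_br_iff_basis .
qed

subsection \<open>Triangular maps\<close>

text \<open>
  The only shape that automorphisms take in the families below. An invertible triangular map has a
  constant diagonal, so only \<open>b\<close> has to be a polynomial.
\<close>

definition tri :: "complex \<Rightarrow> complex poly \<Rightarrow> complex \<Rightarrow> complex \<Rightarrow> 'r \<Rightarrow> 'r" where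
  "tri a b d x = block [:a:] b 0 [:d:] [:x:]"

lemma tri_compose:
  "tri a' b' d' x' \<circ> tri a b d x = tri (a * a') (smult a b' + smult d' b) (d * d') (x * x')"
  by (simp add: tri_def block_compose mult.commute)

lemma bij_tri:
  assumes "a \<noteq> 0" "d \<noteq> 0" "x \<noteq> 0"
  shows "bij (tri a b d x)"
proof (rule o_bij)
  have id: "tri 1 0 1 1 = id"
  proof
    fix v
    obtain k l m where "v = vec k l m" using vec_exists by metis
    then show "tri 1 0 1 1 v = id v" by (simp add: tri_def block_vec)
  qed
  let ?h = "tri (1 / a) (smult (- 1 / (a * d)) b) (1 / d) (1 / x)"
  show "?h \<circ> tri a b d x = id" "tri a b d x \<circ> ?h = id"
    using assms by (simp_all add: tri_compose id[symmetric] smult_add_left[symmetric])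
qed

text \<open>
  Surjectivity makes each diagonal entry divide \<open>1\<close>, hence a nonzero constant: \<open>a\<close> because \<open>A\<close> is in
  the image, then \<open>d\<close> because \<open>B\<close> is, where \<open>a \<noteq> 0\<close> is used, and \<open>x\<close> because \<open>X\<close> is.
\<close>

lemma bij_block_triangular:
  assumes "bij (block a b 0 d x)"
  obtains a' d' x' where "block a b 0 d x = tri a' b d' x'" "a' \<noteq> 0" "d' \<noteq> 0" "x' \<noteq> 0"
proof -
  have surj: "\<exists>k l m. block a b 0 d x (vec k l m) = w" for w
    using assms vec_exists by (metis bij_pointE)
  obtain k l m where "k * a = 1" using surj[of "vec 1 0 0"] by (auto simp: block_vec)
  then have "a dvd 1" by (metis dvd_triv_right)
  then obtain a' where a: "a = [:a':]" "a' \<noteq> 0" by (auto simp: is_unit_poly_iff dvd_field_iff)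
  obtain k l m where "k * a = 0" "k * b + l * d = 1" using surj[of "vec 0 1 0"] by (auto simp: block_vec)
  then have "l * d = 1" using a by auto
  then have "d dvd 1" by (metis dvd_triv_right)
  then obtain d' where d: "d = [:d':]" "d' \<noteq> 0" by (auto simp: is_unit_poly_iff dvd_field_iff)
  obtain k l m where "m * x = 1" using surj[of "vec 0 0 1"] by (auto simp: block_vec)
  then have "x dvd 1" by (metis dvd_triv_right)
  then obtain x' where x: "x = [:x':]" "x' \<noteq> 0" by (auto simp: is_unit_poly_iff dvd_field_iff)
  show thesis by (rule that[of a' d' x']) (use a d x in \<open>simp_all add: tri_def\<close>)
qed

text \<open>
  The common last step for all families: if every automorphism has \<open>c = 0\<close>, the automorphism group is
  the set of admissible quadruples \<open>(a, b, d, x)\<close> under the composition law of triangular maps, so a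
  multiplicative parametrisation \<open>k\<close> of that set by \<open>G\<close> gives the isomorphism.
\<close>

lemma Aut_isoI:
  fixes G :: "'g monoid" and k :: "'g \<Rightarrow> complex \<times> complex poly \<times> complex \<times> complex"
  assumes tri: "\<And>a b c d x. block a b c d x \<in> carrier (Aut R) \<Longrightarrow> c = 0"
    and adm: "\<And>a b d x. tri a b d x \<in> carrier (Aut R) \<longleftrightarrow> (\<exists>y\<in>carrier G. k y = (a, b, d, x))"
    and inj: "inj_on k (carrier G)"
    and closed: "\<And>y z. y \<in> carrier G \<Longrightarrow> z \<in> carrier G \<Longrightarrow> y \<otimes>\<^bsub>G\<^esub> z \<in> carrier G"
    and mult: "\<And>y z a b d x a' b' d' x'. y \<in> carrier G \<Longrightarrow> z \<in> carrier G \<Longrightarrow>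
      k y = (a', b', d', x') \<Longrightarrow> k z = (a, b, d, x) \<Longrightarrow>
      k (y \<otimes>\<^bsub>G\<^esub> z) = (a' * a, smult a b' + smult d' b, d' * d, x' * x)"
  shows "Aut R \<cong> G"
proof -
  let ?h = "\<lambda>(a, b, d, x). tri a b d x"
  have tri_eq: "tri a b d x = tri a' b' d' x' \<longleftrightarrow> (a, b, d, x) = (a', b', d', x')" for a b d x a' b' d' x'
    by (simp add: tri_def block_eq_iff)
  have bij: "bij_betw (?h \<circ> k) (carrier G) (carrier (Aut R))"
  proof (rule bij_betw_imageI)
    show "inj_on (?h \<circ> k) (carrier G)"
      by (intro comp_inj_on inj) (auto simp: inj_on_def tri_eq split: prod.splits)
    show "(?h \<circ> k) ` carrier G = carrier (Aut R)"
    proof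
      show "(?h \<circ> k) ` carrier G \<subseteq> carrier (Aut R)"
      proof
        fix \<sigma> assume "\<sigma> \<in> (?h \<circ> k) ` carrier G"
        then obtain y a b d x where "y \<in> carrier G" "k y = (a, b, d, x)" "\<sigma> = tri a b d x"
          by (auto split: prod.splits)
        then show "\<sigma> \<in> carrier (Aut R)" using adm by blast
      qed
      show "carrier (Aut R) \<subseteq> (?h \<circ> k) ` carrier G"
      proof
        fix \<sigma> assume \<sigma>: "\<sigma> \<in> carrier (Aut R)"
        then obtain a b c d x where block: "\<sigma> = block a b c d x" by (rule Aut_eq_block)
        with \<sigma> tri have "c = 0" by blast
        moreover have "bij \<sigma>" using \<sigma> by (simp add: Aut_def)
        ultimately obtain a' d' x' where "\<sigma> = tri a' b d' x'"
          using bij_block_triangular block by metis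
        moreover from this \<sigma> adm obtain y where "y \<in> carrier G" "k y = (a', b, d', x')" by blast
        ultimately show "\<sigma> \<in> (?h \<circ> k) ` carrier G" by force
      qed
    qed
  qed
  have hom: "(?h \<circ> k) (y \<otimes>\<^bsub>G\<^esub> z) = (?h \<circ> k) y \<circ> (?h \<circ> k) z"
    if "y \<in> carrier G" "z \<in> carrier G" for y z
  proof -
    obtain a' b' d' x' a b d x where "k y = (a', b', d', x')" "k z = (a, b, d, x)"
      by (metis prod_cases4)
    then show ?thesis using mult[OF that] by (simp add: tri_compose mult.commute)
  qed
  let ?i = "inv_into (carrier G) (?h \<circ> k)"
  have mem: "?i \<sigma> \<in> carrier G" and inv: "(?h \<circ> k) (?i \<sigma>) = \<sigma>" if "\<sigma> \<in> carrier (Aut R)" for \<sigma>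
    using that bij inv_into_into f_inv_into_f unfolding bij_betw_def by metis+
  have "?i (\<sigma> \<circ> \<tau>) = ?i \<sigma> \<otimes>\<^bsub>G\<^esub> ?i \<tau>"
    if "\<sigma> \<in> carrier (Aut R)" "\<tau> \<in> carrier (Aut R)" for \<sigma> \<tau>
  proof -
    have "\<sigma> \<circ> \<tau> = (?h \<circ> k) (?i \<sigma> \<otimes>\<^bsub>G\<^esub> ?i \<tau>)"
      using that hom mem inv by metis
    then show ?thesis
      using bij_betw_inv_into_left[OF bij] closed mem that by metis
  qed
  then have "?i \<in> hom (Aut R) G"
    by (intro homI) (use mem in \<open>simp_all add: Aut_def\<close>)
  then show ?thesis
    using bij_betw_inv_into[OF bij] by (auto simp: is_iso_def iso_def)
qed

end

section \<open>Automorphisms in terms of the structure polynomials\<close>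

text \<open>
  All families have brackets of this shape, so the conditions for being an automorphism are
  computed once, in terms of the eight structure polynomials.
\<close>

locale conf_brackets = conf_basis +
  fixes fA fB p g q h u w :: "complex poly poly"
  assumes br_basis: "br R A A = actv fA fB 0" "br R A B = actv 0 p 0" "br R A X = actv 0 0 g"
    "br R B B = actv 0 q 0" "br R B X = actv 0 0 h" "br R X X = actv u w 0"
begin

lemma br_BA: "br R B A = actv 0 (- flip p) 0"
proof -
  have "A \<in> part R 0" "B \<in> part R 0" using basis by (auto simp: super_basis_def)
  from br_skew[OF this(2,1)] show ?thesis
    by (simp add: super_sign_def br_basis skew_subst_actv actv_uminus ev_eq_iff)
qed

lemma br_even_even:
  "br R (vec a b 0) (vec c d 0) =
    actv (at_minus_lam a * at_sum c * fA)
      (at_minus_lam a * at_sum c * fB + at_minus_lam a * at_sum d * p -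
       at_minus_lam b * at_sum c * flip p + at_minus_lam b * at_sum d * q) 0"
  by (simp add: vec_def br_add br_scl[OF br_basis(1)] br_scl[OF br_basis(2)] br_scl[OF br_basis(4)]
      br_scl[OF br_BA] actv_add algebra_simps)

lemma br_even_odd:
  "br R (vec a b 0) (vec 0 0 x) = actv 0 0 ((at_minus_lam a * g + at_minus_lam b * h) * at_sum x)"
  by (simp add: vec_def br_add br_scl[OF br_basis(3)] br_scl[OF br_basis(5)] actv_add algebra_simps)

lemma br_odd_odd:
  "br R (vec 0 0 x) (vec 0 0 y) =
    actv (at_minus_lam x * at_sum y * u) (at_minus_lam x * at_sum y * w) 0"
  by (simp add: vec_def br_scl[OF br_basis(6)])

lemma block_in_Aut_iff:
  "block a b c d x \<in> carrier (Aut R) \<longleftrightarrow> bij (block a b c d x) \<and>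
    (\<forall>s t.
      poly a s * ev fA s t + poly c s * ev fB s t = poly a (- t) * poly a (s + t) * ev fA s t \<and>
      poly b s * ev fA s t + poly d s * ev fB s t =
        poly a (- t) * poly a (s + t) * ev fB s t + poly a (- t) * poly b (s + t) * ev p s t -
        poly b (- t) * poly a (s + t) * ev p s (- t - s) + poly b (- t) * poly b (s + t) * ev q s t \<and>
      poly c s * ev p s t = poly a (- t) * poly c (s + t) * ev fA s t \<and>
      poly d s * ev p s t =
        poly a (- t) * poly c (s + t) * ev fB s t + poly a (- t) * poly d (s + t) * ev p s t -
        poly b (- t) * poly c (s + t) * ev p s (- t - s) + poly b (- t) * poly d (s + t) * ev q s t \<and>
      poly x s * ev g s t = (poly a (- t) * ev g s t + poly b (- t) * ev h s t) * poly x (s + t) \<and>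
      poly c s * ev q s t = poly c (- t) * poly c (s + t) * ev fA s t \<and>
      poly d s * ev q s t =
        poly c (- t) * poly c (s + t) * ev fB s t + poly c (- t) * poly d (s + t) * ev p s t -
        poly d (- t) * poly c (s + t) * ev p s (- t - s) + poly d (- t) * poly d (s + t) * ev q s t \<and>
      poly x s * ev h s t = (poly c (- t) * ev g s t + poly d (- t) * ev h s t) * poly x (s + t) \<and>
      poly a s * ev u s t + poly c s * ev w s t = poly x (- t) * poly x (s + t) * ev u s t \<and>
      poly b s * ev u s t + poly d s * ev w s t = poly x (- t) * poly x (s + t) * ev w s t)"
  unfolding block_in_Aut_iff_basis block_basis br_basis map_poly_block_actv br_even_even
    br_even_odd br_odd_odd actv_eq_iff
  by (simp add: ev_eq_iff all_conj_distrib)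

text \<open>
  Specialising to \<open>c = 0\<close> and a constant diagonal, where factors \<open>a\<close>, \<open>d\<close>, \<open>x\<close> common to both sides
  of an identity cancel because they are nonzero.
\<close>

lemma tri_in_Aut_iff:
  "tri a b d x \<in> carrier (Aut R) \<longleftrightarrow> a \<noteq> 0 \<and> d \<noteq> 0 \<and> x \<noteq> 0 \<and>
    (\<forall>s t.
      ev fA s t = a * ev fA s t \<and>
      poly b s * ev fA s t + d * ev fB s t =
        a\<^sup>2 * ev fB s t + a * poly b (s + t) * ev p s t -
        a * poly b (- t) * ev p s (- t - s) + poly b (- t) * poly b (s + t) * ev q s t \<and>
      ev p s t = a * ev p s t + poly b (- t) * ev q s t \<and>
      ev g s t = a * ev g s t + poly b (- t) * ev h s t \<and>
      ev q s t = d * ev q s t \<and>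
      ev h s t = d * ev h s t \<and>
      a * ev u s t = x\<^sup>2 * ev u s t \<and>
      poly b s * ev u s t + d * ev w s t = x\<^sup>2 * ev w s t)"
proof (cases "a \<noteq> 0 \<and> d \<noteq> 0 \<and> x \<noteq> 0")
  case True
  then have [simp]: "a \<noteq> 0" "d \<noteq> 0" "x \<noteq> 0" by auto
  have cancel: "k * y = a * (k * z) + k * v \<longleftrightarrow> y = a * z + v" if "k \<noteq> 0" for k y z v
  proof -
    have "k * y = a * (k * z) + k * v \<longleftrightarrow> k * y = k * (a * z + v)" by (simp add: algebra_simps)
    then show ?thesis using that by simp
  qed
  have "bij (block [:a:] b 0 [:d:] [:x:])" using bij_tri[of a d x b] by (simp add: tri_def)
  then show ?thesis
    unfolding tri_def block_in_Aut_iff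
    by (simp add: power2_eq_square cancel[of d] cancel[of x] algebra_simps)
next
  case False
  have "\<not> bij (tri a b d x)"
  proof
    assume "bij (tri a b d x)"
    then obtain a' d' x' where "block [:a:] b 0 [:d:] [:x:] = tri a' b d' x'" "a' \<noteq> 0" "d' \<noteq> 0" "x' \<noteq> 0"
      using bij_block_triangular unfolding tri_def by metis
    then show False using False by (simp add: tri_def block_eq_iff)
  qed
  then show ?thesis using False by (auto simp: Aut_def)
qed

end

section \<open>Polynomial identities and signs\<close>

lemma ev_mult_poly_eq_0:
  assumes "F \<noteq> 0" "\<And>s t. poly c s * ev F s t = 0"
  shows "c = 0"
proof -
  have "in_D c * F = 0" using assms(2) by (simp add: ev_eq_iff)
  then show "c = 0" using assms(1) by (simp add: in_D_def)
qed

lemma vir_neq_0: "vir \<noteq> 0" and vir_mod_neq_0: "vir_mod \<alpha> \<beta> \<noteq> 0"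
proof -
  have "ev vir 1 0 \<noteq> ev 0 1 0" by simp
  then show "vir \<noteq> 0" by metis
  have "ev (vir_mod \<alpha> \<beta>) (1 - \<beta>) 0 \<noteq> ev 0 (1 - \<beta>) 0" by simp
  then show "vir_mod \<alpha> \<beta> \<noteq> 0" by metis
qed

text \<open>
  Both substitutions \<open>a \<mapsto> a(-\<lambda>)\<close> and \<open>c \<mapsto> c(\<partial> + \<lambda>)\<close> are injective, and \<open>\<complex>[\<partial>, \<lambda>]\<close> is a domain.
\<close>

lemma vir_product_eq_0:
  assumes "\<And>s t. poly a (- t) * poly c (s + t) * ev vir s t = 0"
  shows "a = 0 \<or> c = 0"
proof -
  have "at_minus_lam a * at_sum c * vir = 0" using assms by (simp add: ev_eq_iff)
  then have "at_minus_lam a = 0 \<or> at_sum c = 0" using vir_neq_0 by simp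
  then show ?thesis
  proof
    assume "at_minus_lam a = 0"
    then have "poly a (- (- t)) = 0" for t by (metis ev_at(1) ev_simps(1))
    then show ?thesis by (simp add: poly_all_0_iff_0[symmetric])
  next
    assume "at_sum c = 0"
    then have "poly c (t + 0) = 0" for t by (metis ev_at(2) ev_simps(1))
    then show ?thesis by (simp add: poly_all_0_iff_0[symmetric])
  qed
qed

definition reflect :: "complex poly \<Rightarrow> complex poly" where
  "reflect p = pcompose p [:0, - 1:]"

lemma poly_reflect [simp]: "poly (reflect p) s = poly p (- s)"
  by (simp add: reflect_def poly_pcompose)

lemma reflect_eq_0 [simp]: "reflect p = 0 \<longleftrightarrow> p = 0"
proof
  assume "reflect p = 0"
  then have "poly p s = 0" for s using poly_reflect[of p "- s"] by simp
  then show "p = 0" by (simp add: poly_all_0_iff_0[symmetric])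
qed (simp add: reflect_def)

text \<open>
  With \<open>y = -s - t\<close> the condition reads \<open>b(-y) p(t) = b(-t) p(y)\<close> for all \<open>t\<close> and \<open>y\<close>. Fixing \<open>y\<close> with
  \<open>p(y) \<noteq> 0\<close> gives \<open>b(-t) = k p(t)\<close> for the constant \<open>k = b(-y) / p(y)\<close>.
\<close>

lemma proportional_iff:
  assumes "p \<noteq> 0"
  shows "(\<forall>s t. poly b (s + t) * poly p t = poly b (- t) * poly p (- t - s)) \<longleftrightarrow>
    (\<exists>k. b = smult k (reflect p))"
proof
  assume *: "\<forall>s t. poly b (s + t) * poly p t = poly b (- t) * poly p (- t - s)"
  obtain y where y: "poly p y \<noteq> 0" using assms poly_all_0_iff_0 by blast
  have "poly b s = poly (smult (poly b (- y) / poly p y) (reflect p)) s" for s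
  proof -
    have "poly b s * poly p y = poly b (- y) * poly p (- s)"
      using *[rule_format, of "s - y" y] by simp
    then show ?thesis using y by (simp add: nonzero_eq_divide_eq)
  qed
  then have "poly b = poly (smult (poly b (- y) / poly p y) (reflect p))" by blast
  then have "b = smult (poly b (- y) / poly p y) (reflect p)"
    by (simp only: poly_eq_poly_eq_iff)
  then show "\<exists>k. b = smult k (reflect p)" by blast
qed (auto simp: algebra_simps minus_diff_commute)

lemma smult_cancel_left [simp]:
  "smult k p = smult k q \<longleftrightarrow> k = 0 \<or> p = q" for p q :: "complex poly"
  using smult_eq_0_iff[of k "p - q"] by (auto simp: smult_diff_right)

lemma smult_cancel_right [simp]:
  "smult k p = smult l p \<longleftrightarrow> k = l \<or> p = 0" for p :: "complex poly"
  using smult_eq_0_iff[of "k - l" p] by (auto simp: smult_diff_left)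

definition sign_of :: "bit \<Rightarrow> complex" where
  "sign_of e = (if e = 0 then 1 else - 1)"

lemma sign_of_0 [simp]: "sign_of 0 = 1"
  by (simp add: sign_of_def)

lemma sign_of_add: "sign_of (e + e') = sign_of e * sign_of e'"
  by (cases e; cases e') (simp_all add: sign_of_def)

lemma sign_of_eq_iff [simp]: "sign_of e = sign_of e' \<longleftrightarrow> e = e'"
  by (cases e; cases e') (simp_all add: sign_of_def)

lemma sign_of_neq_0 [simp]: "sign_of e \<noteq> 0"
  by (simp add: sign_of_def)

lemma sign_of_square [simp]: "sign_of e * sign_of e = 1" "(sign_of e)\<^sup>2 = 1"
  by (simp_all add: sign_of_def)

lemma square_eq_1_iff_sign: "x\<^sup>2 = 1 \<longleftrightarrow> (\<exists>e. x = sign_of e)"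
  by (auto simp: power2_eq_1_iff sign_of_def intro: exI[of _ 0] exI[of _ 1])

lemmas group_simps = Cstar_def additive_def Cstar_semi_C_def Cstar_semi_CD_def semidirect_def
  DirProd_def

section \<open>The nine families\<close>

context conf_basis
begin

lemma actv_single: "act R F A = actv F 0 0" "act R F B = actv 0 F 0" "act R F X = actv 0 0 F"
  by (simp_all add: actv_def)

lemma not_bij_block: "\<not> bij (block 0 0 c d x)" "\<not> bij (block a b c d 0)"
proof -
  have "block 0 0 c d x A = block 0 0 c d x 0" "A \<noteq> 0"
    using vec_eq_0[of 1 0 0] by (simp_all add: block_basis vec_basis)
  then show "\<not> bij (block 0 0 c d x)" by (metis bij_def injD)
  have "block a b c d 0 X = block a b c d 0 0" "X \<noteq> 0"
    using vec_eq_0[of 0 0 1] by (simp_all add: block_basis vec_basis)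
  then show "\<not> bij (block a b c d 0)" by (metis bij_def injD)
qed

subsection \<open>Families without a Virasoro element\<close>

lemma conf_brackets_A1:
  assumes "alg_A1 R A B X f \<phi>"
  shows "conf_brackets R A B X 0 f 0 (in_L \<phi>) 0 0 0 0"
  by unfold_locales (use assms in \<open>simp_all add: alg_A1_def brackets_def actv_single\<close>)

text \<open>
  The bracket \<open>[\<sigma>(A)\<^sub>\<lambda> \<sigma>(A)]\<close> is a multiple of \<open>B\<close>, and it equals \<open>f \<sigma>(B)\<close>.
\<close>

lemma A1_triangular:
  assumes "alg_A1 R A B X f \<phi>" "block a b c d x \<in> carrier (Aut R)"
  shows "c = 0"
proof -
  interpret conf_brackets R A B X 0 f 0 "in_L \<phi>" 0 0 0 0
    by (rule conf_brackets_A1) fact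
  show "c = 0"
    using assms by (intro ev_mult_poly_eq_0[of f]) (simp_all add: block_in_Aut_iff alg_A1_def)
qed

lemma A1_admissible:
  assumes "alg_A1 R A B X f \<phi>"
  shows "tri a b d x \<in> carrier (Aut R) \<longleftrightarrow> a \<noteq> 0 \<and> x \<noteq> 0 \<and> d = a\<^sup>2 \<and> (\<phi> \<noteq> 0 \<longrightarrow> a = 1)"
proof -
  interpret conf_brackets R A B X 0 f 0 "in_L \<phi>" 0 0 0 0
    by (rule conf_brackets_A1) fact
  have "\<exists>s t. ev f s t \<noteq> 0" using assms ev_eq_iff[of f 0] by (auto simp: alg_A1_def)
  moreover have "\<phi> \<noteq> 0 \<longleftrightarrow> (\<exists>t. poly \<phi> t \<noteq> 0)" by (metis poly_all_0_iff_0)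
  ultimately show ?thesis unfolding tri_in_Aut_iff by auto
qed

text \<open>
  For a composite \<open>(a'', b'', d'', x'')\<close> the composition law gives
  \<open>b'' = a b' + a'\<^sup>2 b\<close>, so \<open>v = b / a\<close> satisfies \<open>v'' = v' + a' v\<close>.
\<close>

lemma Aut_A1_zero:
  assumes "alg_A1 R A B X f 0"
  shows "Aut R \<cong> Cstar_semi_CD 1 \<times>\<times> Cstar"
proof (rule Aut_isoI[where k = "\<lambda>((z, v), x). (z, smult z v, z\<^sup>2, x)"])
  fix a b d x
  show "tri a b d x \<in> carrier (Aut R) \<longleftrightarrow>
    (\<exists>y\<in>carrier (Cstar_semi_CD 1 \<times>\<times> Cstar).
      (\<lambda>((z, v), x). (z, smult z v, z\<^sup>2, x)) y = (a, b, d, x))"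
    unfolding A1_admissible[OF assms]
    by (auto simp: group_simps intro!: exI[of _ "smult (1 / a) b"])
qed (use A1_triangular[OF assms] in
    \<open>auto simp: group_simps inj_on_def power2_eq_square algebra_simps smult_add_right\<close>)

lemma Aut_A1_nonzero:
  assumes "alg_A1 R A B X f \<phi>" "\<phi> \<noteq> 0"
  shows "Aut R \<cong> CD_add \<times>\<times> Cstar"
proof (rule Aut_isoI[where k = "\<lambda>(v, x). (1, v, 1, x)"])
  fix a b d x
  show "tri a b d x \<in> carrier (Aut R) \<longleftrightarrow>
    (\<exists>y\<in>carrier (CD_add \<times>\<times> Cstar). (case y of (v, x) \<Rightarrow> (1, v, 1, x)) = (a, b, d, x))"
    unfolding A1_admissible[OF assms(1)] using assms(2) by (auto simp: group_simps)
qed (use A1_triangular[OF assms(1)] in \<open>auto simp: group_simps inj_on_def add.commute\<close>)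

lemma conf_brackets_A2:
  assumes "alg_A2 R A B X f \<psi>"
  shows "conf_brackets R A B X 0 f 0 0 0 0 0 (in_D \<psi>)"
  by unfold_locales (use assms in \<open>simp_all add: alg_A2_def brackets_def actv_single\<close>)

lemma A2_triangular:
  assumes "alg_A2 R A B X f \<psi>" "block a b c d x \<in> carrier (Aut R)"
  shows "c = 0"
proof -
  interpret conf_brackets R A B X 0 f 0 0 0 0 0 "in_D \<psi>"
    by (rule conf_brackets_A2) fact
  show "c = 0"
    using assms by (intro ev_mult_poly_eq_0[of f]) (simp_all add: block_in_Aut_iff alg_A2_def)
qed

text \<open>
  The bracket \<open>[X\<^sub>\<lambda> X] = \<psi> B\<close> requires \<open>d = x\<^sup>2\<close> next to \<open>d = a\<^sup>2\<close> when \<open>\<psi> \<noteq> 0\<close>, which leaves a sign.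
\<close>

lemma A2_admissible:
  assumes "alg_A2 R A B X f \<psi>"
  shows "tri a b d x \<in> carrier (Aut R) \<longleftrightarrow>
    a \<noteq> 0 \<and> x \<noteq> 0 \<and> d = a\<^sup>2 \<and> (\<psi> \<noteq> 0 \<longrightarrow> (\<exists>e. x = a * sign_of e))"
proof -
  interpret conf_brackets R A B X 0 f 0 0 0 0 0 "in_D \<psi>"
    by (rule conf_brackets_A2) fact
  have "\<exists>s t. ev f s t \<noteq> 0" using assms ev_eq_iff[of f 0] by (auto simp: alg_A2_def)
  moreover have "\<psi> \<noteq> 0 \<longleftrightarrow> (\<exists>t. poly \<psi> t \<noteq> 0)" by (metis poly_all_0_iff_0)
  ultimately have "tri a b d x \<in> carrier (Aut R) \<longleftrightarrow>
      a \<noteq> 0 \<and> x \<noteq> 0 \<and> d = a\<^sup>2 \<and> (\<psi> \<noteq> 0 \<longrightarrow> a\<^sup>2 = x\<^sup>2)"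
    unfolding tri_in_Aut_iff by auto
  also have "a\<^sup>2 = x\<^sup>2 \<longleftrightarrow> (\<exists>e. x = a * sign_of e)"
  proof
    assume "a\<^sup>2 = x\<^sup>2"
    then have "x = a * sign_of 0 \<or> x = a * sign_of 1"
      by (auto simp: power2_eq_iff sign_of_def)
    then show "\<exists>e. x = a * sign_of e" by blast
  qed (auto simp: power_mult_distrib)
  finally show ?thesis .
qed

lemma Aut_A2_zero:
  assumes "alg_A2 R A B X f 0"
  shows "Aut R \<cong> Cstar_semi_CD 1 \<times>\<times> Cstar"
proof (rule Aut_isoI[where k = "\<lambda>((z, v), x). (z, smult z v, z\<^sup>2, x)"])
  fix a b d x
  show "tri a b d x \<in> carrier (Aut R) \<longleftrightarrow>
    (\<exists>y\<in>carrier (Cstar_semi_CD 1 \<times>\<times> Cstar).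
      (\<lambda>((z, v), x). (z, smult z v, z\<^sup>2, x)) y = (a, b, d, x))"
    unfolding A2_admissible[OF assms]
    by (auto simp: group_simps intro!: exI[of _ "smult (1 / a) b"])
qed (use A2_triangular[OF assms] in
    \<open>auto simp: group_simps inj_on_def power2_eq_square algebra_simps smult_add_right\<close>)

lemma Aut_A2_nonzero:
  assumes "alg_A2 R A B X f \<psi>" "\<psi> \<noteq> 0"
  shows "Aut R \<cong> Cstar_semi_CD 1 \<times>\<times> Z2_add"
proof (rule Aut_isoI[where k = "\<lambda>((z, v), e). (z, smult z v, z\<^sup>2, z * sign_of e)"])
  fix a b d x
  show "tri a b d x \<in> carrier (Aut R) \<longleftrightarrow>
    (\<exists>y\<in>carrier (Cstar_semi_CD 1 \<times>\<times> Z2_add).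
      (\<lambda>((z, v), e). (z, smult z v, z\<^sup>2, z * sign_of e)) y = (a, b, d, x))"
    unfolding A2_admissible[OF assms(1)] using assms(2)
    by (auto simp: group_simps intro!: exI[of _ "smult (1 / a) b"])
qed (use A2_triangular[OF assms(1)] in \<open>auto simp: group_simps inj_on_def power2_eq_square
      algebra_simps smult_add_right sign_of_add\<close>)

text \<open>
  The condition from \<open>[X\<^sub>\<lambda> X] = 2 B\<close> is \<open>d = x\<^sup>2\<close>, and the composition law for \<open>b = k \<phi>(-\<partial>)\<close> is
  \<open>k'' = k' + d' k\<close>: the weight is \<open>2\<close> in terms of \<open>x\<close>.
\<close>

lemma Aut_A3:
  assumes "alg_A3 R A B X \<phi>"
  shows "Aut R \<cong> Cstar_semi_C 2"
proof (rule Aut_isoI[where k = "\<lambda>(z, k). (1, smult k (reflect \<phi>), z\<^sup>2, z)"])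
  interpret conf_brackets R A B X 0 0 "2 * in_L \<phi>" "in_L \<phi>" 0 0 0 2
    by unfold_locales (use assms in \<open>simp_all add: alg_A3_def brackets_def actv_single\<close>)
  have phi: "\<phi> \<noteq> 0" using assms by (simp add: alg_A3_def)
  then obtain t0 where t0: "poly \<phi> t0 \<noteq> 0" using poly_all_0_iff_0 by blast
  show "c = 0" if "block a b c d x \<in> carrier (Aut R)" for a b c d x
  proof -
    have "poly c s = 0" for s using that by (simp add: block_in_Aut_iff)
    then show "c = 0" by (simp add: poly_all_0_iff_0[symmetric])
  qed
  show "tri a b d x \<in> carrier (Aut R) \<longleftrightarrow> (\<exists>y\<in>carrier (Cstar_semi_C 2).
      (case y of (z, k) \<Rightarrow> (1, smult k (reflect \<phi>), z\<^sup>2, z)) = (a, b, d, x))" for a b d x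
  proof -
    have "tri a b d x \<in> carrier (Aut R) \<longleftrightarrow> a = 1 \<and> x \<noteq> 0 \<and> d = x\<^sup>2 \<and>
        (\<forall>s t. poly b (s + t) * poly \<phi> t = poly b (- t) * poly \<phi> (- t - s))"
      unfolding tri_in_Aut_iff using t0 by auto
    then show ?thesis unfolding proportional_iff[OF phi] by (auto simp: group_simps)
  qed
  show "inj_on (\<lambda>(z, k). (1, smult k (reflect \<phi>), z\<^sup>2, z)) (carrier (Cstar_semi_C 2))"
    using phi by (auto simp: inj_on_def)
qed (auto simp: group_simps power2_eq_square algebra_simps smult_add_left)

text \<open>
  Here \<open>d\<close> and \<open>x\<close> are independent, and \<open>b = k p(-\<partial>)\<close> is scaled by \<open>d\<close>, so the weight is \<open>1\<close>.
\<close>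

lemma Aut_A4:
  assumes "alg_A4 R A B X p \<phi>"
  shows "Aut R \<cong> Cstar_semi_C 1 \<times>\<times> Cstar"
proof (rule Aut_isoI[where k = "\<lambda>((z, k), x). (1, smult k (reflect p), z, x)"])
  interpret conf_brackets R A B X 0 0 "in_L p" "in_L \<phi>" 0 0 0 0
    by unfold_locales (use assms in \<open>simp_all add: alg_A4_def brackets_def actv_single\<close>)
  have p: "p \<noteq> 0" using assms by (simp add: alg_A4_def)
  then obtain t0 where t0: "poly p t0 \<noteq> 0" using poly_all_0_iff_0 by blast
  show "c = 0" if "block a b c d x \<in> carrier (Aut R)" for a b c d x
  proof -
    have "poly c s * poly p t0 = 0" for s using that by (simp add: block_in_Aut_iff)
    then show "c = 0" using t0 by (simp add: poly_all_0_iff_0[symmetric])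
  qed
  show "tri a b d x \<in> carrier (Aut R) \<longleftrightarrow> (\<exists>y\<in>carrier (Cstar_semi_C 1 \<times>\<times> Cstar).
      (\<lambda>((z, k), x). (1, smult k (reflect p), z, x)) y = (a, b, d, x))" for a b d x
  proof -
    have "tri a b d x \<in> carrier (Aut R) \<longleftrightarrow> a = 1 \<and> d \<noteq> 0 \<and> x \<noteq> 0 \<and>
        (\<forall>s t. poly b (s + t) * poly p t = poly b (- t) * poly p (- t - s))"
      unfolding tri_in_Aut_iff using t0 by auto
    then show ?thesis unfolding proportional_iff[OF p] by (auto simp: group_simps)
  qed
  show "inj_on (\<lambda>((z, k), x). (1, smult k (reflect p), z, x)) (carrier (Cstar_semi_C 1 \<times>\<times> Cstar))"
    using p by (auto simp: inj_on_def)
qed (auto simp: group_simps algebra_simps smult_add_left)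

subsection \<open>Families with a Virasoro element\<close>

text \<open>
  If \<open>a = 0\<close>, then \<open>\<sigma>(A)\<close> is a multiple of \<open>B\<close> and brackets trivially with \<open>X\<close>, although \<open>[A\<^sub>\<lambda> X] \<noteq> 0\<close>;
  this rules out that the two Virasoro elements are exchanged.
\<close>

lemma B_triangular:
  assumes "conf_brackets R A B X vir 0 0 (vir_mod \<alpha> \<beta>) q 0 u w"
    "block a b c d x \<in> carrier (Aut R)"
  shows "c = 0"
proof -
  interpret conf_brackets R A B X vir 0 0 "vir_mod \<alpha> \<beta>" q 0 u w by fact
  have bij: "bij (block a b c d x)" and c: "\<And>s t. poly a (- t) * poly c (s + t) * ev vir s t = 0"
    and x: "\<And>s t. poly x s * ev (vir_mod \<alpha> \<beta>) s t =
      poly a (- t) * ev (vir_mod \<alpha> \<beta>) s t * poly x (s + t)"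
    using assms(2) by (simp_all add: block_in_Aut_iff)
  have "a \<noteq> 0"
  proof
    assume "a = 0"
    then have "x = 0" using x by (intro ev_mult_poly_eq_0[OF vir_mod_neq_0]) simp
    then show False using bij not_bij_block by blast
  qed
  then show "c = 0" using vir_product_eq_0[OF c] by blast
qed

text \<open>
  The coefficient of \<open>B\<close> in \<open>\<sigma>([A\<^sub>\<lambda> A])\<close> is \<open>b (\<partial> + 2\<lambda>)\<close>, while \<open>[\<sigma>(A)\<^sub>\<lambda> \<sigma>(A)]\<close> has none. Hence
  \<open>b = 0\<close>, and \<open>a = 0\<close> would give \<open>\<sigma>(A) = 0\<close>.
\<close>

lemma C_triangular:
  assumes "conf_brackets R A B X vir 0 0 g 0 h u w" "block a b c d x \<in> carrier (Aut R)"
  shows "c = 0"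
proof -
  interpret conf_brackets R A B X vir 0 0 g 0 h u w by fact
  have bij: "bij (block a b c d x)" and c: "\<And>s t. poly a (- t) * poly c (s + t) * ev vir s t = 0"
    and b: "\<And>s t. poly b s * ev vir s t = 0"
    using assms(2) by (simp_all add: block_in_Aut_iff)
  have "b = 0" using b by (rule ev_mult_poly_eq_0[OF vir_neq_0])
  then have "a \<noteq> 0" using bij not_bij_block by blast
  then show "c = 0" using vir_product_eq_0[OF c] by blast
qed

text \<open>
  The condition \<open>[A\<^sub>\<lambda> B] = 0\<close> reads \<open>b(-\<lambda>) (\<partial> + 2\<lambda>) = 0\<close> up to the factor \<open>d \<noteq> 0\<close>, which gives
  \<open>b = 0\<close>. The polynomial \<open>u\<close> is the coefficient of \<open>A\<close> in \<open>[X\<^sub>\<lambda> X]\<close>; it ties \<open>x\<^sup>2\<close> to \<open>a = 1\<close>.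
\<close>

lemma B_admissible:
  assumes "conf_brackets R A B X vir 0 0 g vir 0 u 0"
  shows "tri a b d x \<in> carrier (Aut R) \<longleftrightarrow>
    a = 1 \<and> b = 0 \<and> d = 1 \<and> x \<noteq> 0 \<and> (u \<noteq> 0 \<longrightarrow> x\<^sup>2 = 1)"
proof -
  interpret conf_brackets R A B X vir 0 0 g vir 0 u 0 by fact
  have u: "u \<noteq> 0 \<longleftrightarrow> (\<exists>s t. ev u s t \<noteq> 0)" by (simp add: ev_eq_iff)
  show ?thesis
  proof
    assume *: "tri a b d x \<in> carrier (Aut R)"
    then have "ev vir 1 0 = a * ev vir 1 0" "ev vir 1 0 = d * ev vir 1 0"
      unfolding tri_in_Aut_iff by blast+
    then have "a = 1" "d = 1" by simp_all
    moreover have "poly b (- t) = 0 \<or> s + 2 * t = 0" for s t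
      using * unfolding tri_in_Aut_iff by simp
    from this[of "- s" "1 + 2 * s" for s] have "b = 0" by (simp add: poly_all_0_iff_0[symmetric])
    ultimately show "a = 1 \<and> b = 0 \<and> d = 1 \<and> x \<noteq> 0 \<and> (u \<noteq> 0 \<longrightarrow> x\<^sup>2 = 1)"
      using * unfolding tri_in_Aut_iff u by auto
  qed (unfold tri_in_Aut_iff u, auto)
qed

lemma C_admissible:
  assumes "conf_brackets R A B X vir 0 0 g 0 h u 0"
  shows "tri a b d x \<in> carrier (Aut R) \<longleftrightarrow>
    a = 1 \<and> b = 0 \<and> d \<noteq> 0 \<and> x \<noteq> 0 \<and> (h \<noteq> 0 \<longrightarrow> d = 1) \<and> (u \<noteq> 0 \<longrightarrow> x\<^sup>2 = 1)"
proof -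
  interpret conf_brackets R A B X vir 0 0 g 0 h u 0 by fact
  have u: "u \<noteq> 0 \<longleftrightarrow> (\<exists>s t. ev u s t \<noteq> 0)" and h: "h \<noteq> 0 \<longleftrightarrow> (\<exists>s t. ev h s t \<noteq> 0)"
    by (simp_all add: ev_eq_iff)
  show ?thesis
  proof
    assume *: "tri a b d x \<in> carrier (Aut R)"
    then have "ev vir 1 0 = a * ev vir 1 0" unfolding tri_in_Aut_iff by blast
    then have "a = 1" by simp
    moreover have "poly b s * ev vir s t = 0" for s t
      using * unfolding tri_in_Aut_iff by simp
    then have "b = 0" by (rule ev_mult_poly_eq_0[OF vir_neq_0])
    ultimately show "a = 1 \<and> b = 0 \<and> d \<noteq> 0 \<and> x \<noteq> 0 \<and> (h \<noteq> 0 \<longrightarrow> d = 1) \<and> (u \<noteq> 0 \<longrightarrow> x\<^sup>2 = 1)"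
      using * unfolding tri_in_Aut_iff u h by auto
  qed (unfold tri_in_Aut_iff u h, auto)
qed

lemma Aut_B1:
  assumes "alg_B1 R A B X \<alpha> \<beta>"
  shows "Aut R \<cong> Cstar"
proof -
  have br: "conf_brackets R A B X vir 0 0 (vir_mod \<alpha> \<beta>) vir 0 0 0"
    by unfold_locales (use assms in \<open>simp_all add: alg_B1_def brackets_def actv_single\<close>)
  show ?thesis
    by (rule Aut_isoI[where k = "\<lambda>x. (1, 0, 1, x)"])
      (use B_triangular[OF br] B_admissible[OF br] in \<open>auto simp: group_simps inj_on_def\<close>)
qed

lemma Aut_B2:
  assumes "alg_B2 R A B X"
  shows "Aut R \<cong> Z2_add"
proof -
  have br: "conf_brackets R A B X vir 0 0 (vir_mod (3 / 2) 0) vir 0 2 0"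
    by unfold_locales (use assms in \<open>simp_all add: alg_B2_def brackets_def actv_single\<close>)
  show ?thesis
    by (rule Aut_isoI[where k = "\<lambda>e. (1, 0, 1, sign_of e)"])
      (use B_triangular[OF br] B_admissible[OF br] in
        \<open>auto simp: group_simps inj_on_def sign_of_add square_eq_1_iff_sign\<close>)
qed

lemma Aut_C1:
  assumes "alg_C1 R A B X \<alpha> \<beta>"
  shows "Aut R \<cong> Cstar \<times>\<times> Cstar"
proof -
  have br: "conf_brackets R A B X vir 0 0 (vir_mod \<alpha> \<beta>) 0 0 0 0"
    by unfold_locales (use assms in \<open>simp_all add: alg_C1_def brackets_def actv_single\<close>)
  show ?thesis
    by (rule Aut_isoI[where k = "\<lambda>(d, x). (1, 0, d, x)"])
      (use C_triangular[OF br] C_admissible[OF br] in \<open>auto simp: group_simps inj_on_def\<close>)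
qed

lemma Aut_C2:
  assumes "alg_C2 R A B X"
  shows "Aut R \<cong> Cstar \<times>\<times> Z2_add"
proof -
  have br: "conf_brackets R A B X vir 0 0 (vir_mod (3 / 2) 0) 0 0 2 0"
    by unfold_locales (use assms in \<open>simp_all add: alg_C2_def brackets_def actv_single\<close>)
  show ?thesis
    by (rule Aut_isoI[where k = "\<lambda>(d, e). (1, 0, d, sign_of e)"])
      (use C_triangular[OF br] C_admissible[OF br] in
        \<open>auto simp: group_simps inj_on_def sign_of_add square_eq_1_iff_sign\<close>)
qed

lemma Aut_C3:
  assumes "alg_C3 R A B X \<phi>"
  shows "Aut R \<cong> Cstar"
proof -
  have br: "conf_brackets R A B X vir 0 0 0 0 (in_L \<phi>) 0 0"
    by unfold_locales (use assms in \<open>simp_all add: alg_C3_def brackets_def actv_single\<close>)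
  have "\<phi> \<noteq> 0" using assms by (simp add: alg_C3_def)
  then have "in_L \<phi> \<noteq> 0" by (auto simp: ev_eq_iff poly_all_0_iff_0)
  then show ?thesis
    by (intro Aut_isoI[where k = "\<lambda>x. (1, 0, 1, x)"])
      (use C_triangular[OF br] C_admissible[OF br] in \<open>auto simp: group_simps inj_on_def\<close>)
qed

end

theorem theorem4p3:
  fixes R :: "'r::ab_group_add conf_structure" and A B X :: 'r
  assumes "lie_conformal_superalgebra R" and "super_basis R A B X"
  shows
    "(\<forall>f \<phi>. alg_A1 R A B X f \<phi> \<longrightarrow>
        (\<phi> = 0 \<longrightarrow> (\<exists>m. m \<noteq> 0 \<and> Aut R \<cong> Cstar_semi_CD m \<times>\<times> Cstar)) \<and>
        (\<phi> \<noteq> 0 \<longrightarrow> Aut R \<cong> CD_add \<times>\<times> Cstar)) \<and>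
     (\<forall>f \<psi>. alg_A2 R A B X f \<psi> \<longrightarrow>
        (\<psi> = 0 \<longrightarrow> (\<exists>m. m \<noteq> 0 \<and> Aut R \<cong> Cstar_semi_CD m \<times>\<times> Cstar)) \<and>
        (\<psi> \<noteq> 0 \<longrightarrow> (\<exists>m. m \<noteq> 0 \<and> Aut R \<cong> Cstar_semi_CD m \<times>\<times> Z2_add))) \<and>
     (\<forall>\<phi>. alg_A3 R A B X \<phi> \<longrightarrow> (\<exists>m. m \<noteq> 0 \<and> Aut R \<cong> Cstar_semi_C m)) \<and>
     (\<forall>p \<phi>. alg_A4 R A B X p \<phi> \<longrightarrow> (\<exists>m. m \<noteq> 0 \<and> Aut R \<cong> Cstar_semi_C m \<times>\<times> Cstar)) \<and>
     (\<forall>\<alpha> \<beta>. alg_B1 R A B X \<alpha> \<beta> \<longrightarrow> Aut R \<cong> Cstar) \<and>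
     (alg_B2 R A B X \<longrightarrow> Aut R \<cong> Z2_add) \<and>
     (\<forall>\<alpha> \<beta>. alg_C1 R A B X \<alpha> \<beta> \<longrightarrow> Aut R \<cong> Cstar \<times>\<times> Cstar) \<and>
     (alg_C2 R A B X \<longrightarrow> Aut R \<cong> Cstar \<times>\<times> Z2_add) \<and>
     (\<forall>\<phi>. alg_C3 R A B X \<phi> \<longrightarrow> Aut R \<cong> Cstar)"
proof -
  interpret conf_basis R A B X by unfold_locales fact+
  show ?thesis
  proof (intro conjI allI impI)
    fix f \<phi> assume A1: "alg_A1 R A B X f \<phi>"
    show "\<exists>m. m \<noteq> 0 \<and> Aut R \<cong> Cstar_semi_CD m \<times>\<times> Cstar" if "\<phi> = 0"
      using Aut_A1_zero A1 that by (intro exI[of _ 1]) simp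
    show "Aut R \<cong> CD_add \<times>\<times> Cstar" if "\<phi> \<noteq> 0"
      using Aut_A1_nonzero A1 that .
  next
    fix f \<psi> assume A2: "alg_A2 R A B X f \<psi>"
    show "\<exists>m. m \<noteq> 0 \<and> Aut R \<cong> Cstar_semi_CD m \<times>\<times> Cstar" if "\<psi> = 0"
      using Aut_A2_zero A2 that by (intro exI[of _ 1]) simp
    show "\<exists>m. m \<noteq> 0 \<and> Aut R \<cong> Cstar_semi_CD m \<times>\<times> Z2_add" if "\<psi> \<noteq> 0"
      using Aut_A2_nonzero A2 that by (intro exI[of _ 1]) simp
  next
    fix \<phi> assume "alg_A3 R A B X \<phi>"
    then show "\<exists>m. m \<noteq> 0 \<and> Aut R \<cong> Cstar_semi_C m"
      using Aut_A3 by (intro exI[of _ 2]) simp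
  next
    fix p \<phi> assume "alg_A4 R A B X p \<phi>"
    then show "\<exists>m. m \<noteq> 0 \<and> Aut R \<cong> Cstar_semi_C m \<times>\<times> Cstar"
      using Aut_A4 by (intro exI[of _ 1]) simp
  qed (fact Aut_B1 Aut_B2 Aut_C1 Aut_C2 Aut_C3)+
qed

end
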